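(* Let $d\ge 1$, $\Omega=(-\pi,\pi)^d$ with periodic boundary conditions, and let $\lambda\in[0,1]$. Consider the exponential Euler scheme with time step size $\tau>0$ $$u^{n+1}=u^{n}+\tau\varphi_{1}(\tau\lambda\Delta)\Delta u^{n}$$ for the heat equation $\partial_t u=\lambda\Delta u+(1-\lambda)\Delta u$ on $\Omega$. If $\lambda\ge 1/2$, then this scheme is unconditionally stable.
   Context: The function $\varphi_1(z)=(\mathrm{e}^z-1)/z$, with $\varphi_1(0)=1$, is entire; functions of $\Delta$ act on periodic functions as Fourier multipliers, $\Delta$ acting on the $\boldsymbol k$-th Fourier mode ($\boldsymbol k\in\mathbb{Z}^d$) as multiplication by $-k^2$, where $k^2=\sum_{\mu=1}^d k_\mu^2$. The scheme therefore acts on each Fourier coefficient $\hat u^n_{\boldsymbol k}$ of $u^n$ by $\hat u^{n+1}_{\boldsymbol k}=\Phi(z,\lambda)\,\hat u^n_{\boldsymbol k}$ with $z=-\tau k^2$, where the stability function $\Phi(z,\lambda)$ is the scalar amplification factor obtained by formally replacing every occurrence of $\tau\Delta$ in the scheme by the real number $z$. The scheme (with parameter $\lambda$) is called unconditionally stable if $|\Phi(z,\lambda)|\le 1$ for all $z\in(-\infty,0]$. *)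

theory Defs
  imports "HOL-Analysis.Analysis"
begin

definition phi1 :: "complex \<Rightarrow> complex" where
  "phi1 z = (if z = 0 then 1 else (exp z - 1) / z)"

definition Omega :: "(real ^ 'd) set" where
  "Omega = box (\<chi> i. - pi) (\<chi> i. pi)"

text \<open>Integrability is the weakest regularity under which all Fourier coefficients exist.
  Real-valued functions are included as complex-valued ones.\<close>

definition periodic_fun :: "(real ^ 'd \<Rightarrow> complex) \<Rightarrow> bool" where
  "periodic_fun u \<longleftrightarrow>
     (\<forall>x i. u (x + axis i (2 * pi)) = u x) \<and> u absolutely_integrable_on Omega"

definition fourier_coeff :: "(real ^ 'd \<Rightarrow> complex) \<Rightarrow> int ^ 'd \<Rightarrow> complex" where
  "fourier_coeff u k =
     (LINT x:Omega|lebesgue. u x * exp (- \<i> * of_real (\<Sum>i\<in>UNIV. of_int (k $ i) * x $ i)))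
       / of_real ((2 * pi) ^ CARD('d))"

definition mode_sq :: "int ^ 'd \<Rightarrow> real" where
  "mode_sq k = (\<Sum>i\<in>UNIV. (of_int (k $ i))\<^sup>2)"

text \<open>\<open>fun_laplacian f u w\<close> means \<open>w = f(\<Delta>) u\<close>. It is a relation because \<open>f(\<Delta>)\<close> may be
  unbounded; \<open>w\<close> is determined by \<open>u\<close> up to null sets.\<close>

definition fun_laplacian ::
    "(complex \<Rightarrow> complex) \<Rightarrow> (real ^ 'd \<Rightarrow> complex) \<Rightarrow> (real ^ 'd \<Rightarrow> complex) \<Rightarrow> bool" where
  "fun_laplacian f u w \<longleftrightarrow> periodic_fun u \<and> periodic_fun w \<and>
     (\<forall>k. fourier_coeff w k = f (of_real (- mode_sq k)) * fourier_coeff u k)"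

text \<open>One step \<open>v = u + \<tau> \<phi>\<^sub>1(\<tau>\<lambda>\<Delta>)\<Delta> u\<close>. The product \<open>\<phi>\<^sub>1(\<tau>\<lambda>\<Delta>)\<Delta>\<close> is taken as a single
  function of \<open>\<Delta>\<close>, so that \<open>\<Delta> u\<close> itself need not be a function.\<close>

definition exp_euler_step ::
    "real \<Rightarrow> real \<Rightarrow> (real ^ 'd \<Rightarrow> complex) \<Rightarrow> (real ^ 'd \<Rightarrow> complex) \<Rightarrow> bool" where
  "exp_euler_step lam \<tau> u v \<longleftrightarrow> periodic_fun u \<and> periodic_fun v \<and>
     (\<exists>w. fun_laplacian (\<lambda>s. phi1 (of_real \<tau> * of_real lam * s) * s) u w \<and>
          (AE x in lebesgue. v x = u x + of_real \<tau> * w x))"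

text \<open>The step with \<open>\<tau>\<Delta>\<close> replaced by \<open>z\<close>.\<close>

definition stability_fun :: "real \<Rightarrow> real \<Rightarrow> complex" where
  "stability_fun z lam = 1 + phi1 (of_real lam * of_real z) * of_real z"

text \<open>\<open>amplification_factor S \<Phi>\<close>: a step of size \<open>\<tau>\<close> of the scheme \<open>S\<close> multiplies the Fourier
  coefficient of mode \<open>k\<close> by \<open>\<Phi>(-\<tau> k\<^sup>2)\<close>.\<close>

definition amplification_factor ::
    "(real \<Rightarrow> (real ^ 'd \<Rightarrow> complex) \<Rightarrow> (real ^ 'd \<Rightarrow> complex) \<Rightarrow> bool) \<Rightarrow> (real \<Rightarrow> complex) \<Rightarrow> bool" where
  "amplification_factor S \<Phi> \<longleftrightarrow>
     (\<forall>\<tau>>0. \<forall>u v. S \<tau> u v \<longrightarrow>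
        (\<forall>k. fourier_coeff v k = \<Phi> (- \<tau> * mode_sq k) * fourier_coeff u k))"

definition unconditionally_stable :: "(real \<Rightarrow> complex) \<Rightarrow> bool" where
  "unconditionally_stable \<Phi> \<longleftrightarrow> (\<forall>z\<le>0. cmod (\<Phi> z) \<le> 1)"

end

theory Submission
  imports Defs
begin

text \<open>The first claim is linearity of Fourier coefficients. For the second, when \<open>z \<noteq> 0\<close> the
  stability function is \<open>1 - (1 - exp (\<lambda> z)) / \<lambda>\<close>; for \<open>z \<le> 0\<close> and \<open>\<lambda> > 0\<close> it lies
  in \<open>[1 - 1/\<lambda>, 1]\<close>, which is contained in \<open>[-1, 1]\<close> as soon as \<open>\<lambda> \<ge> 1/2\<close>.\<close>

lemma set_integrable_mult_character:
  fixes u :: "real ^ 'd \<Rightarrow> complex" and k :: "int ^ 'd"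
  assumes "set_integrable lebesgue A u"
  shows "set_integrable lebesgue A
           (\<lambda>x. u x * exp (- \<i> * of_real (\<Sum>i\<in>UNIV. of_int (k $ i) * x $ i)))"
proof -
  let ?e = "\<lambda>x :: real ^ 'd. exp (- \<i> * of_real (\<Sum>i\<in>UNIV. of_int (k $ i) * x $ i))"
  have int_u: "integrable lebesgue (\<lambda>x. indicator A x *\<^sub>R u x)"
    using assms unfolding set_integrable_def .
  have "continuous_on UNIV ?e"
    by (intro continuous_intros)
  then have meas_e: "?e \<in> borel_measurable lebesgue"
    by (intro measurable_completion) (simp add: borel_measurable_continuous_onI)
  have "integrable lebesgue (\<lambda>x. (indicator A x *\<^sub>R u x) * ?e x)"
  \<comment> \<open>The exponent is purely imaginary, so the character has modulus 1 and the product
    is dominated by \<open>u\<close> on \<open>A\<close>.\<close>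
  proof (rule Bochner_Integration.integrable_bound[OF int_u])
    show "(\<lambda>x. (indicator A x *\<^sub>R u x) * ?e x) \<in> borel_measurable lebesgue"
      using borel_measurable_integrable[OF int_u] meas_e by (rule borel_measurable_times)
  qed (simp add: norm_mult)
  then show ?thesis
    unfolding set_integrable_def by simp
qed

text \<open>Integrals ignore null sets, so an equation holding almost everywhere, as in
  \<open>exp_euler_step\<close>, is enough. Integrability lets the integral of the sum be
  split.\<close>

lemma fourier_coeff_linear_AE:
  fixes u v w :: "real ^ 'd \<Rightarrow> complex"
  assumes u: "set_integrable lebesgue Omega u" and w: "set_integrable lebesgue Omega w"
    and v: "set_integrable lebesgue Omega v"
    and eq: "AE x in lebesgue. v x = u x + c * w x"
  shows "fourier_coeff v k = fourier_coeff u k + c * fourier_coeff w k"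
proof -
  define e where
    "e x = exp (- \<i> * of_real (\<Sum>i\<in>UNIV. of_int (k $ i) * x $ i))" for x :: "real ^ 'd"
  note int = set_integrable_mult_character[of _ _ k, folded e_def]
  have int_cw: "set_integrable lebesgue Omega (\<lambda>x. c * (w x * e x))"
    using int[OF w] by simp
  have "(LINT x:Omega|lebesgue. v x * e x) =
        (LINT x:Omega|lebesgue. u x * e x + c * (w x * e x))"
    unfolding set_lebesgue_integral_def
  proof (rule integral_cong_AE)
    show "(\<lambda>x. indicator Omega x *\<^sub>R (v x * e x)) \<in> borel_measurable lebesgue"
      using int[OF v] unfolding set_integrable_def by (rule borel_measurable_integrable)
    show "(\<lambda>x. indicator Omega x *\<^sub>R (u x * e x + c * (w x * e x))) \<in> borel_measurable lebesgue"
      using set_integral_add(1)[OF int[OF u] int_cw]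
      unfolding set_integrable_def by (rule borel_measurable_integrable)
    show "AE x in lebesgue. indicator Omega x *\<^sub>R (v x * e x) =
            indicator Omega x *\<^sub>R (u x * e x + c * (w x * e x))"
      using eq by eventually_elim (simp add: algebra_simps)
  qed
  also have "\<dots> = (LINT x:Omega|lebesgue. u x * e x) + c * (LINT x:Omega|lebesgue. w x * e x)"
    using set_integral_add(2)[OF int[OF u] int_cw] by simp
  finally show ?thesis
    unfolding fourier_coeff_def e_def by (simp add: add_divide_distrib)
qed

lemma exp_euler_amplification_factor:
  "amplification_factor
     (exp_euler_step lam :: real \<Rightarrow> (real ^ 'd \<Rightarrow> complex) \<Rightarrow> (real ^ 'd \<Rightarrow> complex) \<Rightarrow> bool)
     (\<lambda>z. stability_fun z lam)"
  unfolding amplification_factor_def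
proof (intro allI impI)
  fix \<tau> :: real and u v :: "real ^ 'd \<Rightarrow> complex" and k
  assume "exp_euler_step lam \<tau> u v"
  then obtain w where "periodic_fun u" "periodic_fun v"
    and lap: "fun_laplacian (\<lambda>s. phi1 (of_real \<tau> * of_real lam * s) * s) u w"
    and eq: "AE x in lebesgue. v x = u x + of_real \<tau> * w x"
    unfolding exp_euler_step_def by blast
  moreover have "periodic_fun w"
    using lap unfolding fun_laplacian_def by blast
  ultimately have "fourier_coeff v k = fourier_coeff u k + of_real \<tau> * fourier_coeff w k"
    unfolding periodic_fun_def by (intro fourier_coeff_linear_AE) auto
  also have "fourier_coeff w k = phi1 (of_real \<tau> * of_real lam * of_real (- mode_sq k))
      * of_real (- mode_sq k) * fourier_coeff u k"
    using lap unfolding fun_laplacian_def by blast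
  \<comment> \<open>With z = -\<tau> k^2, the outer factor \<tau> turns -k^2 into z and the argument
    of \<open>phi1\<close> is \<lambda> z, so the multiplier depends on \<tau> and k only through
    z.\<close>
  finally show "fourier_coeff v k = stability_fun (- \<tau> * mode_sq k) lam * fourier_coeff u k"
    unfolding stability_fun_def by (simp add: algebra_simps)
qed

text \<open>For z \<noteq> 0 the factor z cancels against the denominator \<lambda> z of
  \<open>phi1\<close>, leaving 1/\<lambda>; at z = 0 both sides are 1. The value is real, so its
  modulus is an ordinary absolute value.\<close>

lemma stability_fun_eq:
  assumes "lam \<noteq> 0"
  shows "stability_fun z lam = of_real (1 - (1 - exp (lam * z)) / lam)"
  using assms
  by (auto simp: stability_fun_def phi1_def exp_of_real[symmetric] field_simps)

text \<open>The threshold 1/2 comes from the limit z \<rightarrow> -\<infinity>, where the factor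
  tends to 1 - 1/\<lambda>; this is at least -1 for positive \<lambda> exactly when \<lambda> \<ge>
  1/2.\<close>

lemma exp_euler_unconditionally_stable:
  assumes "lam \<ge> 1 / 2"
  shows "unconditionally_stable (\<lambda>z. stability_fun z lam)"
  unfolding unconditionally_stable_def
proof (intro allI impI)
  fix z :: real
  assume "z \<le> 0"
  let ?q = "(1 - exp (lam * z)) / lam"
  have "lam * z \<le> 0"
    using assms \<open>z \<le> 0\<close> by (simp add: mult_nonneg_nonpos)
  then have "0 \<le> ?q"
    using assms by simp
  moreover have "?q \<le> 2"
  proof -
    \<comment> \<open>The left side is below 1 because the exponential is positive, and 1 \<le> 2
      \<lambda>.\<close>
    have "1 - exp (lam * z) \<le> 2 * lam"
      using assms exp_gt_zero[of "lam * z"] by linarith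
    then show ?thesis
      using assms by (simp add: pos_divide_le_eq)
  qed
  ultimately have "\<bar>1 - ?q\<bar> \<le> 1"
    by linarith
  moreover have "stability_fun z lam = of_real (1 - ?q)"
    using assms by (intro stability_fun_eq) simp
  ultimately show "cmod (stability_fun z lam) \<le> 1"
    by (simp only: norm_of_real)
qed

text \<open>The first conjunct ties the scalar function to the scheme acting on periodic functions,
  so that the bound in the second is a statement about the scheme.\<close>

theorem theorem2p1:
  fixes lam :: real
  assumes "0 \<le> lam" and "lam \<le> 1"
    and "lam \<ge> 1 / 2"
  shows "amplification_factor
           (exp_euler_step lam :: real \<Rightarrow> (real ^ 'd \<Rightarrow> complex) \<Rightarrow> (real ^ 'd \<Rightarrow> complex) \<Rightarrow> bool)
           (\<lambda>z. stability_fun z lam)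
       \<and> unconditionally_stable (\<lambda>z. stability_fun z lam)"
  using exp_euler_amplification_factor exp_euler_unconditionally_stable[OF assms(3)] by blast

end
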